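(* Let $\eta>0$, and let $M$, $K$, $m$ be the mass matrix, stiffness matrix and mean-value vector of the piecewise linear finite element space described in the context, with $\bar K = K + mm^T$. Then the eigenvalues $\lambda$ satisfy $$\lambda\left(\begin{pmatrix} \bar K + \eta^{-1/2}M & 0\\ 0 & \eta \bar K + \eta^{1/2} M\end{pmatrix}^{-1}\begin{pmatrix} \bar K & M\\ M & -\eta \bar K\end{pmatrix}\right) \in \left(-1,-\tfrac{1}{\sqrt2}\right) \cup \left(\tfrac{1}{\sqrt2},1\right).$$
   Context: Let $\Omega=(0,1)\times(0,1)$, let $\mathcal{T}_h$ be a triangulation of $\Omega$ with node set $\mathcal{N}_h$, $n=|\mathcal{N}_h|$, and let $(\lambda_p)_{p\in\mathcal{N}_h}$ be the nodal basis of the space of continuous functions on $\bar\Omega$ that are linear on each triangle (no boundary conditions imposed). The mass matrix is $M=(\int_\Omega \lambda_p\lambda_q\,dx)_{p,q}$, the stiffness matrix is $K=(\int_\Omega \nabla\lambda_p\cdot\nabla\lambda_q\,dx)_{p,q}$, and $m=(\int_\Omega\lambda_p\,dx)_p\in\mathbb{R}^n$. The parameter is $\eta=\epsilon\tau>0$, with $\epsilon>0$ the interface parameter and $\tau>0$ the time step. For a matrix $Z$ with real eigenvalues, $\lambda(Z)\in I$ means that every eigenvalue of $Z$ lies in the set $I$.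
   Formalization: The intervals are proved closed at ±1/√2 for all η>0, and open as printed only when η^{-1/2} is not an eigenvalue of the pencil (K̄,M); the printed claim fails otherwise, e.g. at η=1, where constant functions give the eigenvalues ±1/√2. *)

theory Defs
  imports
    "HOL-Analysis.Analysis"
    "Jordan_Normal_Form.Gauss_Jordan_Elimination"
    "Jordan_Normal_Form.Spectral_Radius"
begin

definition Omega :: "(real \<times> real) set" where
  "Omega = {0<..<1} \<times> {0<..<1}"

(* The library predicate triangulation says that finitely many closed simplices
   (of any dimension) meet pairwise in a common, possibly empty, face. *)
definition triangulation_of_Omega :: "(real \<times> real) set set \<Rightarrow> bool" where
  "triangulation_of_Omega \<T> \<longleftrightarrow>
     triangulation \<T> \<and> (\<forall>T\<in>\<T>. 2 simplex T) \<and> \<Union>\<T> = closure Omega"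

definition nodes :: "(real \<times> real) set set \<Rightarrow> (real \<times> real) set" where
  "nodes \<T> = {p. \<exists>T\<in>\<T>. p extreme_point_of T}"

(* Elements are total functions; only their values on closure Omega are constrained. *)
definition fe_space :: "(real \<times> real) set set \<Rightarrow> (real \<times> real \<Rightarrow> real) set" where
  "fe_space \<T> =
     {v. continuous_on (closure Omega) v \<and>
         (\<forall>T\<in>\<T>. \<exists>a g. \<forall>x\<in>T. v x = a + inner g x)}"

(* On closure Omega these conditions determine each basis function uniquely. *)
definition nodal_basis ::
  "(real \<times> real) set set \<Rightarrow> (real \<times> real \<Rightarrow> real \<times> real \<Rightarrow> real) \<Rightarrow> bool" where
  "nodal_basis \<T> \<phi> \<longleftrightarrow>
     (\<forall>p\<in>nodes \<T>. \<phi> p \<in> fe_space \<T> \<and>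
        (\<forall>q\<in>nodes \<T>. \<phi> p q = (if p = q then 1 else 0)))"

(* Unspecified where f is not differentiable. For a finite element function this can
   happen in Omega only on triangle edges, a null set that does not affect the integrals. *)
definition gradient :: "(real \<times> real \<Rightarrow> real) \<Rightarrow> real \<times> real \<Rightarrow> real \<times> real" where
  "gradient f x = (THE D. GDERIV f x :> D)"

(* In the following three definitions b 0, ..., b (n - 1) are the basis functions. *)
definition mass_matrix :: "nat \<Rightarrow> (nat \<Rightarrow> real \<times> real \<Rightarrow> real) \<Rightarrow> real mat" where
  "mass_matrix n b = mat n n (\<lambda>(i, j). integral Omega (\<lambda>x. b i x * b j x))"

definition stiffness_matrix :: "nat \<Rightarrow> (nat \<Rightarrow> real \<times> real \<Rightarrow> real) \<Rightarrow> real mat" where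
  "stiffness_matrix n b =
     mat n n (\<lambda>(i, j). integral Omega (\<lambda>x. inner (gradient (b i) x) (gradient (b j) x)))"

definition mean_vector :: "nat \<Rightarrow> (nat \<Rightarrow> real \<times> real \<Rightarrow> real) \<Rightarrow> real vec" where
  "mean_vector n b = vec n (\<lambda>i. integral Omega (b i))"

definition outer_square :: "real vec \<Rightarrow> real mat" where
  "outer_square v = mat (dim_vec v) (dim_vec v) (\<lambda>(i, j). v $ i * v $ j)"

definition preconditioner :: "nat \<Rightarrow> real \<Rightarrow> real mat \<Rightarrow> real mat \<Rightarrow> real mat" where
  "preconditioner n \<eta> Kbar M =
     four_block_mat
       (Kbar + (\<eta> powr (-1/2)) \<cdot>\<^sub>m M) (0\<^sub>m n n)
       (0\<^sub>m n n) (\<eta> \<cdot>\<^sub>m Kbar + (\<eta> powr (1/2)) \<cdot>\<^sub>m M)"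

(* For u with Kbar u = \<kappa> M u the preconditioned matrix has the eigenvalues
   +- sqrt (\<kappa>^2 + s^2) / (\<kappa> + s), s = \<eta> powr (-1/2). Their modulus is 1 / sqrt 2 exactly if
   \<kappa> = s. As \<kappa> = 1 occurs (constant functions), this modulus is attained for \<eta> = 1. *)
definition saddle_matrix :: "real \<Rightarrow> real mat \<Rightarrow> real mat \<Rightarrow> real mat" where
  "saddle_matrix \<eta> Kbar M = four_block_mat Kbar M M ((- \<eta>) \<cdot>\<^sub>m Kbar)"

(* Spectrum over the complex numbers: stating that it lies in the image of a real set
   also states that all eigenvalues are real. *)
definition complex_spectrum :: "real mat \<Rightarrow> complex set" where
  "complex_spectrum A = spectrum (map_mat complex_of_real A)"

end

theory Submission
  imports Defs
begin

text \<open>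
Write \<open>q = sqrt \<eta>\<close>, \<open>N = M / q\<close>, \<open>K\<close> for \<open>Kbar\<close> and \<open>G = K + N\<close>. In the unknowns \<open>x\<close> and
\<open>w = q y\<close>, the eigenvalue equation of the preconditioned saddle point matrix becomes the coupled
pencil
\<open>K x + N w = r G x\<close>, \<open>N x - K w = r G w\<close>,
in which \<open>\<eta>\<close> enters only through \<open>N\<close>. All claims about \<open>r\<close> follow from the positive definiteness of
\<open>K\<close> and \<open>N\<close>, without diagonalizing this pair.

The eigenvalues are real because the saddle point matrix is symmetric and the preconditioner is
positive definite (\<open>generalized_eigenpair_real\<close>). Write \<open>B[v]\<close> for \<open>v \<bullet> B v\<close>. Testing the pencil
with \<open>x\<close> and \<open>w\<close> gives
\<open>(1 - r) (G[x] + G[w]) = 2 K[w] + N[x - w]\<close>, \<open>(1 + r) (G[x] + G[w]) = 2 K[x] + N[x + w]\<close>,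
and hence \<open>\<bar>r\<bar> < 1\<close>. For the lower bound put \<open>S = G\<^sup>-\<^sup>1 K\<close> and \<open>T = G\<^sup>-\<^sup>1 N\<close>. As \<open>S + T = 1\<close>, the two
commute, and applying the pencil twice gives \<open>r\<^sup>2 x = (S\<^sup>2 + T\<^sup>2) x\<close>, that is,
\<open>(S - T)\<^sup>2 x = (2 r\<^sup>2 - 1) x\<close>. As \<open>S - T\<close> is self-adjoint for \<open>G\<close>, this yields \<open>2 r\<^sup>2 \<ge> 1\<close>, with
equality only if \<open>K x = N x\<close> (\<open>coupled_pencil_eigenvalue_bounds\<close>). So the inner endpoints of the
intervals are excluded when \<open>Kbar u = \<eta> powr (-1/2) M u\<close> forces \<open>u = 0\<close>.

It remains to see that \<open>M\<close> and \<open>Kbar\<close> are positive definite. If \<open>v\<close> is the finite element function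
with coefficient vector \<open>c\<close>, then \<open>c \<bullet> M c\<close> is the integral of \<open>v\<^sup>2\<close>, and \<open>c \<bullet> Kbar c\<close> is the
integral of \<open>\<bar>\<nabla>v\<bar>\<^sup>2\<close> plus the square of the integral of \<open>v\<close>. If that sum vanishes, then \<open>v\<close> is
constant on each triangle, hence constant on the connected square; as its mean is zero, \<open>v = 0\<close>
(\<open>pos_def_mass_matrix\<close>, \<open>pos_def_stiffness_plus_mean\<close>).
\<close>

(* Below, $ is the entry of a vector of variable dimension. *)
no_notation vec_nth (infixl "$" 90)

section \<open>Positive definite matrices\<close>

definition pos_def :: "nat \<Rightarrow> real mat \<Rightarrow> bool" where
  "pos_def n A \<longleftrightarrow> A \<in> carrier_mat n n \<and> transpose_mat A = A \<and>
     (\<forall>x\<in>carrier_vec n. x \<noteq> 0\<^sub>v n \<longrightarrow> 0 < scalar_prod x (A *\<^sub>v x))"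

lemma pos_def_nonneg:
  assumes "pos_def n A" "x \<in> carrier_vec n"
  shows "0 \<le> scalar_prod x (A *\<^sub>v x)"
  using assms unfolding pos_def_def by (cases "x = 0\<^sub>v n") (auto intro: less_imp_le)

text \<open>
Two matrices and two vectors, so that \<open>x = y\<close> covers the sum of matrices, the general case block
diagonal matrices, and \<open>A = B\<close> the real and imaginary parts of a complex vector.
\<close>
lemma pos_def_forms_add_pos:
  assumes A: "pos_def n A" and B: "pos_def n B" and x: "x \<in> carrier_vec n" and y: "y \<in> carrier_vec n"
    and nz: "x \<noteq> 0\<^sub>v n \<or> y \<noteq> 0\<^sub>v n"
  shows "0 < scalar_prod x (A *\<^sub>v x) + scalar_prod y (B *\<^sub>v y)"
proof (cases "x = 0\<^sub>v n")
  case True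
  then have "0 < scalar_prod y (B *\<^sub>v y)" using nz B y unfolding pos_def_def by blast
  then show ?thesis using pos_def_nonneg[OF A x] by simp
next
  case False
  then have "0 < scalar_prod x (A *\<^sub>v x)" using A x unfolding pos_def_def by blast
  then show ?thesis using pos_def_nonneg[OF B y] by simp
qed

lemma smult_vec_eq_0D:
  fixes v :: "'a::field vec"
  assumes "c \<cdot>\<^sub>v v = 0\<^sub>v n" "c \<noteq> 0"
  shows "v = 0\<^sub>v n"
proof (rule eq_vecI)
  show d: "dim_vec v = dim_vec (0\<^sub>v n :: 'a vec)"
    using arg_cong[OF assms(1), of dim_vec] by simp
  fix i assume "i < dim_vec (0\<^sub>v n :: 'a vec)"
  then show "v $ i = 0\<^sub>v n $ i"
    using arg_cong[OF assms(1), of "\<lambda>v. v $ i"] assms(2) d by simp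
qed

lemma smult_mat_mult_vec:
  fixes A :: "'a::comm_ring_1 mat"
  assumes "A \<in> carrier_mat nr nc" "v \<in> carrier_vec nc"
  shows "(s \<cdot>\<^sub>m A) *\<^sub>v v = s \<cdot>\<^sub>v (A *\<^sub>v v)"
  using assms by (intro eq_vecI) (auto simp: scalar_prod_def sum_distrib_left mult.assoc)

lemma transpose_smult_mat: "transpose_mat (s \<cdot>\<^sub>m A) = s \<cdot>\<^sub>m transpose_mat A"
  by (rule eq_matI) auto

lemma pos_def_smult:
  assumes "pos_def n A" "0 < s" shows "pos_def n (s \<cdot>\<^sub>m A)"
proof -
  have A: "A \<in> carrier_mat n n" "transpose_mat A = A" using assms by (auto simp: pos_def_def)
  have "scalar_prod x ((s \<cdot>\<^sub>m A) *\<^sub>v x) = s * scalar_prod x (A *\<^sub>v x)" if "x \<in> carrier_vec n" for x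
    using A that by (simp add: smult_mat_mult_vec)
  moreover have "transpose_mat (s \<cdot>\<^sub>m A) = s \<cdot>\<^sub>m A"
    using A(2) by (simp add: transpose_smult_mat)
  ultimately show ?thesis using assms by (auto simp: pos_def_def)
qed

lemma pos_def_add:
  assumes "pos_def n A" "pos_def n B" shows "pos_def n (A + B)"
proof -
  have A: "A \<in> carrier_mat n n" "transpose_mat A = A" and B: "B \<in> carrier_mat n n" "transpose_mat B = B"
    using assms by (auto simp: pos_def_def)
  have "scalar_prod x ((A + B) *\<^sub>v x) = scalar_prod x (A *\<^sub>v x) + scalar_prod x (B *\<^sub>v x)"
    if "x \<in> carrier_vec n" for x
    using A B that by (simp add: add_mult_distrib_mat_vec[where nr=n and nc=n] scalar_prod_add_distrib[where n=n])
  moreover have "transpose_mat (A + B) = A + B"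
    using A B by (simp add: transpose_add[where nr=n and nc=n])
  moreover have "0 < scalar_prod x (A *\<^sub>v x) + scalar_prod x (B *\<^sub>v x)"
    if "x \<in> carrier_vec n" "x \<noteq> 0\<^sub>v n" for x
    using pos_def_forms_add_pos[OF assms] that by blast
  ultimately show ?thesis using A B by (auto simp: pos_def_def)
qed

lemma pos_def_block_diag:
  assumes "pos_def n A" "pos_def n D"
  shows "pos_def (n + n) (four_block_mat A (0\<^sub>m n n) (0\<^sub>m n n) D)"
proof -
  have A: "A \<in> carrier_mat n n" "transpose_mat A = A" and D: "D \<in> carrier_mat n n" "transpose_mat D = D"
    using assms by (auto simp: pos_def_def)
  have "0 < scalar_prod z (four_block_mat A (0\<^sub>m n n) (0\<^sub>m n n) D *\<^sub>v z)"
    if z: "z \<in> carrier_vec (n + n)" "z \<noteq> 0\<^sub>v (n + n)" for z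
  proof -
    define x y where "x = vec_first z n" and "y = vec_last z n"
    have xy: "x \<in> carrier_vec n" "y \<in> carrier_vec n" and zxy: "z = x @\<^sub>v y"
      using z by (auto simp: x_def y_def)
    have car: "A *\<^sub>v x \<in> carrier_vec n" "D *\<^sub>v y \<in> carrier_vec n" using A D xy by auto
    have "x \<noteq> 0\<^sub>v n \<or> y \<noteq> 0\<^sub>v n"
    proof (rule ccontr)
      assume "\<not> ?thesis"
      then have "z = 0\<^sub>v (n + n)" unfolding zxy by (auto intro!: eq_vecI)
      with z show False by blast
    qed
    then have "0 < scalar_prod x (A *\<^sub>v x) + scalar_prod y (D *\<^sub>v y)"
      using pos_def_forms_add_pos[OF assms xy] by blast
    then show ?thesis unfolding zxy mult_mat_vec_split[OF A(1) D(1) xy]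
      using scalar_prod_append[OF xy car] by simp
  qed
  moreover have "transpose_mat (four_block_mat A (0\<^sub>m n n) (0\<^sub>m n n) D) =
      four_block_mat A (0\<^sub>m n n) (0\<^sub>m n n) D"
    using A D by (subst transpose_four_block_mat[OF A(1) _ _ D(1)]) auto
  ultimately show ?thesis using A D by (auto simp: pos_def_def)
qed

text \<open>
This supplies the explicit inverse, since \<open>mat_inverse\<close> returns no value on a singular matrix.
\<close>
lemma pos_def_mat_inverse:
  assumes P: "pos_def n P"
  shows "\<exists>B. mat_inverse P = Some B \<and> B \<in> carrier_mat n n \<and> P * B = 1\<^sub>m n \<and> B * P = 1\<^sub>m n"
proof -
  have C: "P \<in> carrier_mat n n" using P by (auto simp: pos_def_def)
  have "v = 0\<^sub>v n" if v: "v \<in> carrier_vec n" and "P *\<^sub>v v = 0\<^sub>v n" for v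
  proof (rule ccontr)
    assume "v \<noteq> 0\<^sub>v n"
    then have "0 < scalar_prod v (P *\<^sub>v v)" using P v by (auto simp: pos_def_def)
    then show False using that by simp
  qed
  then have "det P \<noteq> 0" using det_0_iff_vec_prod_zero[OF C] by blast
  then have "P \<in> Units (ring_mat TYPE(real) n ())" by (rule det_non_zero_imp_unit[OF C])
  then obtain B where "mat_inverse P = Some B"
    using mat_inverse(1)[OF C, of "()"] by (cases "mat_inverse P") auto
  then show ?thesis using mat_inverse(2)[OF C] by blast
qed

lemma symmetric_form_commute:
  fixes A :: "real mat"
  assumes "A \<in> carrier_mat n n" "transpose_mat A = A" "x \<in> carrier_vec n" "y \<in> carrier_vec n"
  shows "scalar_prod x (A *\<^sub>v y) = scalar_prod y (A *\<^sub>v x)"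
  by (metis assms comm_scalar_prod mult_mat_vec_carrier transpose_vec_mult_scalar)

lemma quadratic_form_linear_combination:
  fixes A :: "real mat"
  assumes A: "A \<in> carrier_mat n n" "transpose_mat A = A" and x: "x \<in> carrier_vec n"
    and w: "w \<in> carrier_vec n"
  shows "scalar_prod (a \<cdot>\<^sub>v x + b \<cdot>\<^sub>v w) (A *\<^sub>v (a \<cdot>\<^sub>v x + b \<cdot>\<^sub>v w)) =
    a\<^sup>2 * scalar_prod x (A *\<^sub>v x) + 2 * a * b * scalar_prod x (A *\<^sub>v w)
      + b\<^sup>2 * scalar_prod w (A *\<^sub>v w)"
proof -
  have 1: "A *\<^sub>v (a \<cdot>\<^sub>v x + b \<cdot>\<^sub>v w) = a \<cdot>\<^sub>v (A *\<^sub>v x) + b \<cdot>\<^sub>v (A *\<^sub>v w)"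
    using assms by (simp add: mult_add_distrib_mat_vec mult_mat_vec)
  have c: "A *\<^sub>v x \<in> carrier_vec n" "A *\<^sub>v w \<in> carrier_vec n"
    using assms by auto
  show ?thesis unfolding 1
    using x w c symmetric_form_commute[OF A w x]
    by (simp add: scalar_prod_add_distrib[where n=n] add_scalar_prod_distrib[where n=n]
        algebra_simps power2_eq_square)
qed

section \<open>Eigenvalues of the coupled pencil\<close>

text \<open>
The bound \<open>\<bar>r\<bar> < 1\<close> and the bound \<open>2 r\<^sup>2 \<ge> 1\<close> come from the identities explained at the
beginning. The vector \<open>(S - T) x\<close> used for the second one needs no inverse of \<open>G\<close>: substituting
\<open>T = 1 - S\<close> in the pencil and solving for \<open>S x\<close> shows that it equals \<open>a = r x - (1 + r) w\<close>.
Self-adjointness of \<open>S - T\<close> then reads \<open>G[a] = (2 r\<^sup>2 - 1) G[x]\<close>.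
\<close>
lemma coupled_pencil_eigenvalue_bounds:
  assumes K: "pos_def n K" and N: "pos_def n N"
    and x: "x \<in> carrier_vec n" and w: "w \<in> carrier_vec n"
    and nz: "x \<noteq> 0\<^sub>v n \<or> w \<noteq> 0\<^sub>v n"
    and e1: "K *\<^sub>v x + N *\<^sub>v w = r \<cdot>\<^sub>v (K *\<^sub>v x + N *\<^sub>v x)"
    and e2: "N *\<^sub>v x - K *\<^sub>v w = r \<cdot>\<^sub>v (K *\<^sub>v w + N *\<^sub>v w)"
  shows "\<bar>r\<bar> < 1" and "1 \<le> 2 * r\<^sup>2"
    and "(\<And>u. u \<in> carrier_vec n \<Longrightarrow> K *\<^sub>v u = N *\<^sub>v u \<Longrightarrow> u = 0\<^sub>v n) \<Longrightarrow> 1 < 2 * r\<^sup>2"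
proof -
  note Kd = K[unfolded pos_def_def] and Nd = N[unfolded pos_def_def]
  have KC: "K \<in> carrier_mat n n" "transpose_mat K = K" and NC: "N \<in> carrier_mat n n" "transpose_mat N = N"
    using Kd Nd by auto
  have car: "K *\<^sub>v u \<in> carrier_vec n" "N *\<^sub>v u \<in> carrier_vec n" if "u \<in> carrier_vec n" for u
    using that KC NC by auto
  define k where "k = (\<lambda>u v. scalar_prod u (K *\<^sub>v v))"
  define h where "h = (\<lambda>u v. scalar_prod u (N *\<^sub>v v))"
  have t1: "k t x + h t w = r * (k t x + h t x)" if "t \<in> carrier_vec n" for t
    using arg_cong[OF e1, of "scalar_prod t"] that x w car[OF x] car[OF w]
    by (simp add: k_def h_def scalar_prod_add_distrib[where n=n])
  have t2: "h t x - k t w = r * (k t w + h t w)" if "t \<in> carrier_vec n" for t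
    using arg_cong[OF e2, of "scalar_prod t"] that x w car[OF x] car[OF w]
    by (simp add: k_def h_def scalar_prod_add_distrib[where n=n] scalar_prod_minus_distrib[where n=n])
  have hk_sym: "k w x = k x w" "h w x = h x w"
    unfolding k_def h_def using symmetric_form_commute KC NC x w by auto
  note eqs = t1[OF x] t1[OF w] t2[OF x] t2[OF w] 
  have kpos: "0 \<le> k u u" "u \<noteq> 0\<^sub>v n \<Longrightarrow> 0 < k u u"
    and hpos: "0 \<le> h u u" "u \<noteq> 0\<^sub>v n \<Longrightarrow> 0 < h u u" if "u \<in> carrier_vec n" for u
    using that pos_def_nonneg[OF K] pos_def_nonneg[OF N] Kd Nd by (auto simp: k_def h_def)
  define gx gw where "gx = k x x + h x x" and "gw = k w w + h w w"
  have gx0: "0 \<le> gx" and gxp: "x \<noteq> 0\<^sub>v n \<Longrightarrow> 0 < gx"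
    using kpos[OF x] hpos[OF x] by (auto simp: gx_def)
  have gw0: "0 \<le> gw" and gwp: "w \<noteq> 0\<^sub>v n \<Longrightarrow> 0 < gw"
    using kpos[OF w] hpos[OF w] by (auto simp: gw_def)
  have comb: "k (a \<cdot>\<^sub>v x + b \<cdot>\<^sub>v w) (a \<cdot>\<^sub>v x + b \<cdot>\<^sub>v w) = a\<^sup>2 * k x x + 2 * a * b * k x w + b\<^sup>2 * k w w"
    "h (a \<cdot>\<^sub>v x + b \<cdot>\<^sub>v w) (a \<cdot>\<^sub>v x + b \<cdot>\<^sub>v w) = a\<^sup>2 * h x x + 2 * a * b * h x w + b\<^sup>2 * h w w" for a b
    unfolding k_def h_def using quadratic_form_linear_combination[OF KC x w] quadratic_form_linear_combination[OF NC x w] by auto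
  \<comment> \<open>The coefficients \<open>1\<close> are kept so that the expansion of quadratic forms applies.\<close>
  have up: "(1 - r) * (gx + gw) = 2 * k w w + h (1 \<cdot>\<^sub>v x + (-1) \<cdot>\<^sub>v w) (1 \<cdot>\<^sub>v x + (-1) \<cdot>\<^sub>v w)"
    unfolding comb gx_def gw_def using eqs hk_sym by (simp add: algebra_simps)
  have lo: "(1 + r) * (gx + gw) = 2 * k x x + h (1 \<cdot>\<^sub>v x + 1 \<cdot>\<^sub>v w) (1 \<cdot>\<^sub>v x + 1 \<cdot>\<^sub>v w)"
    unfolding comb gx_def gw_def using eqs hk_sym by (simp add: algebra_simps)
  have gpos: "0 < gx + gw" using nz gx0 gw0 gxp gwp by (meson add_nonneg_pos add_pos_nonneg)
  have "0 < (1 - r) * (gx + gw)"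
  proof (cases "w = 0\<^sub>v n")
    case True
    then have "1 \<cdot>\<^sub>v x + (-1) \<cdot>\<^sub>v w = x" using x by (intro eq_vecI) auto
    then have "1 \<cdot>\<^sub>v x + (-1) \<cdot>\<^sub>v w \<noteq> 0\<^sub>v n" using nz True by auto
    then show ?thesis unfolding up using hpos(2) kpos(1)[OF w] x w by (auto intro!: add_nonneg_pos)
  next
    case False
    then show ?thesis unfolding up using hpos(1) kpos(2)[OF w] x w by (auto intro!: add_pos_nonneg)
  qed
  moreover have "0 < (1 + r) * (gx + gw)"
  proof (cases "x = 0\<^sub>v n")
    case True
    then have "1 \<cdot>\<^sub>v x + 1 \<cdot>\<^sub>v w = w" using w by (intro eq_vecI) auto
    then have "1 \<cdot>\<^sub>v x + 1 \<cdot>\<^sub>v w \<noteq> 0\<^sub>v n" using nz True by auto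
    then show ?thesis unfolding lo using hpos(2) kpos(1)[OF x] x w by (auto intro!: add_nonneg_pos)
  next
    case False
    then show ?thesis unfolding lo using hpos(1) kpos(2)[OF x] x w by (auto intro!: add_pos_nonneg)
  qed
  ultimately show "\<bar>r\<bar> < 1" using gpos by (auto simp: zero_less_mult_iff)
  \<comment> \<open>This is \<open>(S - T) x\<close>.\<close>
  define a where "a = r \<cdot>\<^sub>v x + (- (1 + r)) \<cdot>\<^sub>v w"
  have ac: "a \<in> carrier_vec n" using x w by (auto simp: a_def)
  have ga: "k a a + h a a = (2 * r\<^sup>2 - 1) * gx"
  proof -
    have key: "(1 + r) * gw - 2 * r * (k x w + h x w) = (r - 1) * gx"
      unfolding gx_def gw_def using eqs[unfolded hk_sym] by (simp add: algebra_simps)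
    have "k a a + h a a = r\<^sup>2 * gx + (1 + r) * ((1 + r) * gw - 2 * r * (k x w + h x w))"
      unfolding a_def comb gx_def gw_def by (simp add: algebra_simps power2_eq_square)
    then show ?thesis unfolding key by (simp add: algebra_simps power2_eq_square)
  qed
  have a0: "a = 0\<^sub>v n" if "k a a + h a a = 0"
    using kpos[OF ac] hpos[OF ac] that by (cases "a = 0\<^sub>v n") auto
  \<comment> \<open>If \<open>x = 0\<close>, then \<open>a = - (1 + r) w\<close> and \<open>G[a] = 0\<close>, which forces \<open>w = 0\<close> because \<open>r > -1\<close>.\<close>
  have xnz: "x \<noteq> 0\<^sub>v n"
  proof
    assume x0: "x = 0\<^sub>v n"
    then have "gx = 0" using KC NC by (auto simp: gx_def k_def h_def scalar_prod_def)
    with ga a0 have "a = 0\<^sub>v n" by simp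
    moreover have "a = (- (1 + r)) \<cdot>\<^sub>v w" using w by (auto simp: a_def x0 intro!: eq_vecI)
    ultimately have "(- (1 + r)) \<cdot>\<^sub>v w = 0\<^sub>v n" by metis
    moreover have "- (1 + r) \<noteq> 0" using \<open>\<bar>r\<bar> < 1\<close> by auto
    ultimately have "w = 0\<^sub>v n" using w smult_vec_eq_0D by blast
    with nz x0 show False by simp
  qed
  have "0 \<le> (2 * r\<^sup>2 - 1) * gx"
    using ga kpos(1)[OF ac] hpos(1)[OF ac] by simp
  with gxp[OF xnz] show ge: "1 \<le> 2 * r\<^sup>2" by (auto simp: zero_le_mult_iff)
  \<comment> \<open>The equation \<open>G (S - T) x = (K - N) x\<close>, a combination of the two equations of the pencil.\<close>
  have Ga: "K *\<^sub>v x - N *\<^sub>v x = K *\<^sub>v a + N *\<^sub>v a"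
  proof (rule eq_vecI)
    fix i assume "i < dim_vec (K *\<^sub>v a + N *\<^sub>v a)"
    then have i: "i < n" using NC by auto
    have E: "(K *\<^sub>v x) $ i + (N *\<^sub>v w) $ i = r * ((K *\<^sub>v x) $ i + (N *\<^sub>v x) $ i)"
      "(N *\<^sub>v x) $ i - (K *\<^sub>v w) $ i = r * ((K *\<^sub>v w) $ i + (N *\<^sub>v w) $ i)"
      using arg_cong[OF e1, of "\<lambda>v. v $ i"] arg_cong[OF e2, of "\<lambda>v. v $ i"] i KC NC
      by (simp_all del: index_mult_mat_vec)
    have L: "(B *\<^sub>v a) $ i = r * (B *\<^sub>v x) $ i - (1 + r) * (B *\<^sub>v w) $ i" if "B \<in> carrier_mat n n" for B
    proof -
      have "B *\<^sub>v a = r \<cdot>\<^sub>v (B *\<^sub>v x) + (- (1 + r)) \<cdot>\<^sub>v (B *\<^sub>v w)"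
        unfolding a_def using that x w by (simp add: mult_add_distrib_mat_vec mult_mat_vec)
      then show ?thesis using that i by (simp del: index_mult_mat_vec add: algebra_simps)
    qed
    show "(K *\<^sub>v x - N *\<^sub>v x) $ i = (K *\<^sub>v a + N *\<^sub>v a) $ i"
      using i KC NC E L[OF KC(1)] L[OF NC(1)] by (simp del: index_mult_mat_vec add: algebra_simps)
  qed (use KC NC in auto)
  show "1 < 2 * r\<^sup>2" if ns: "\<And>u. u \<in> carrier_vec n \<Longrightarrow> K *\<^sub>v u = N *\<^sub>v u \<Longrightarrow> u = 0\<^sub>v n"
  proof (rule ccontr)
    assume "\<not> ?thesis"
    with ge have "2 * r\<^sup>2 - 1 = 0" by simp
    with ga have az: "a = 0\<^sub>v n" by (intro a0) simp
    have "K *\<^sub>v x - N *\<^sub>v x = 0\<^sub>v n"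
      unfolding Ga az using KC NC by (auto intro!: eq_vecI)
    then have d: "(K *\<^sub>v x - N *\<^sub>v x) $ i = 0\<^sub>v n $ i" for i by simp
    have "K *\<^sub>v x = N *\<^sub>v x"
    proof (rule eq_vecI)
      fix i assume "i < dim_vec (N *\<^sub>v x)"
      then show "(K *\<^sub>v x) $ i = (N *\<^sub>v x) $ i"
        using d[of i] KC NC by (simp del: index_mult_mat_vec)
    qed (use KC NC in auto)
    with ns x xnz show False by blast
  qed
qed

lemma one_le_two_square_iff: "1 \<le> 2 * r\<^sup>2 \<longleftrightarrow> 1 / sqrt 2 \<le> \<bar>r\<bar>"
  and one_less_two_square_iff: "1 < 2 * r\<^sup>2 \<longleftrightarrow> 1 / sqrt 2 < \<bar>r\<bar>" for r :: real
proof -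
  have "1 / sqrt 2 \<le> \<bar>r\<bar> \<longleftrightarrow> (1 / sqrt 2)\<^sup>2 \<le> r\<^sup>2" by (simp flip: abs_le_square_iff)
  then show "1 \<le> 2 * r\<^sup>2 \<longleftrightarrow> 1 / sqrt 2 \<le> \<bar>r\<bar>" by (simp add: power_divide mult.commute)
  have "\<bar>r\<bar> \<le> 1 / sqrt 2 \<longleftrightarrow> r\<^sup>2 \<le> (1 / sqrt 2)\<^sup>2" by (simp flip: abs_le_square_iff)
  then show "1 < 2 * r\<^sup>2 \<longleftrightarrow> 1 / sqrt 2 < \<bar>r\<bar>" by (simp add: power_divide mult.commute flip: not_le)
qed

section \<open>Eigenvalues of the preconditioned saddle point matrix\<close>

text \<open>
Multiplying \<open>B A z = c z\<close> by \<open>P\<close> replaces the nonsymmetric product by a generalized eigenvalue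
problem for the pair \<open>(A, P)\<close>, where symmetry can be used.
\<close>
lemma complex_spectrum_inverse_mult:
  assumes A: "A \<in> carrier_mat n n" and P: "P \<in> carrier_mat n n" and B: "B \<in> carrier_mat n n"
    and inv: "P * B = 1\<^sub>m n" and c: "c \<in> complex_spectrum (B * A)"
  shows "\<exists>z. z \<in> carrier_vec n \<and> z \<noteq> 0\<^sub>v n \<and>
    map_mat complex_of_real A *\<^sub>v z = c \<cdot>\<^sub>v (map_mat complex_of_real P *\<^sub>v z)"
proof -
  let ?h = "map_mat complex_of_real"
  obtain z where z: "z \<in> carrier_vec n" "z \<noteq> 0\<^sub>v n" and e: "?h (B * A) *\<^sub>v z = c \<cdot>\<^sub>v z"
    using c A B by (auto simp: complex_spectrum_def spectrum_def eigenvalue_def eigenvector_def)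
  have "?h P *\<^sub>v (?h (B * A) *\<^sub>v z) = (?h P * ?h (B * A)) *\<^sub>v z"
    using A B P z by (intro assoc_mult_mat_vec[symmetric]) auto
  also have "?h P * ?h (B * A) = ?h (P * (B * A))"
    using A B P by (intro of_real_hom.mat_hom_mult[symmetric]) auto
  also have "P * (B * A) = A" using A B P inv by (simp flip: assoc_mult_mat)
  finally have "?h A *\<^sub>v z = c \<cdot>\<^sub>v (?h P *\<^sub>v z)"
    unfolding e using P z by (simp add: mult_mat_vec)
  with z show ?thesis by blast
qed

text \<open>
With \<open>z = x + i y\<close>, the real and imaginary parts of the equation are real equations for \<open>A x\<close> and
\<open>A y\<close>. Testing the first with \<open>y\<close> and the second with \<open>x\<close>, symmetry of \<open>A\<close> and \<open>P\<close> leaves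
\<open>Im c (P[x] + P[y]) = 0\<close>. Hence \<open>c\<close> is real, both \<open>x\<close> and \<open>y\<close> solve the equation, and one of them
is nonzero. So all further arguments take place over the reals.
\<close>
lemma generalized_eigenpair_real:
  fixes A P :: "real mat" and z :: "complex vec"
  assumes A: "A \<in> carrier_mat n n" "transpose_mat A = A" and P: "pos_def n P"
    and z: "z \<in> carrier_vec n" "z \<noteq> 0\<^sub>v n"
    and eq: "map_mat complex_of_real A *\<^sub>v z = c \<cdot>\<^sub>v (map_mat complex_of_real P *\<^sub>v z)"
  shows "\<exists>r v. c = complex_of_real r \<and> v \<in> carrier_vec n \<and> v \<noteq> 0\<^sub>v n \<and> A *\<^sub>v v = r \<cdot>\<^sub>v (P *\<^sub>v v)"
proof -
  have PC: "P \<in> carrier_mat n n" "transpose_mat P = P" using P by (auto simp: pos_def_def)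
  define x y where "x = map_vec Re z" and "y = map_vec Im z"
  have xy: "x \<in> carrier_vec n" "y \<in> carrier_vec n" using z by (auto simp: x_def y_def)
  have nz: "x \<noteq> 0\<^sub>v n \<or> y \<noteq> 0\<^sub>v n"
  proof (rule ccontr)
    assume "\<not> ?thesis"
    then have "map_vec Re z $ i = 0\<^sub>v n $ i" "map_vec Im z $ i = 0\<^sub>v n $ i" for i
      by (auto simp: x_def y_def)
    then have "Re (z $ i) = 0 \<and> Im (z $ i) = 0" if "i < n" for i
      using that carrier_vecD[OF z(1)] by (metis index_map_vec(1) index_zero_vec(1))
    then have "z = 0\<^sub>v n" using z by (intro eq_vecI) (auto simp: complex_eq_iff)
    then show False using z by blast
  qed
  have parts: "Re ((map_mat complex_of_real B *\<^sub>v z) $ i) = (B *\<^sub>v x) $ i"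
       "Im ((map_mat complex_of_real B *\<^sub>v z) $ i) = (B *\<^sub>v y) $ i"
    if "B \<in> carrier_mat n n" "i < n" for B i
    using that z by (auto simp: x_def y_def scalar_prod_def)
  have comp: "(map_mat complex_of_real A *\<^sub>v z) $ i = c * (map_mat complex_of_real P *\<^sub>v z) $ i" if "i < n" for i
    using arg_cong[OF eq, of "\<lambda>v. v $ i"] that A PC by (simp del: index_mult_mat_vec)
  have ex: "A *\<^sub>v x = Re c \<cdot>\<^sub>v (P *\<^sub>v x) + (- Im c) \<cdot>\<^sub>v (P *\<^sub>v y)"
  proof (rule eq_vecI)
    fix i assume "i < dim_vec (Re c \<cdot>\<^sub>v (P *\<^sub>v x) + (- Im c) \<cdot>\<^sub>v (P *\<^sub>v y))"
    then have i: "i < n" using PC by auto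
    show "(A *\<^sub>v x) $ i = (Re c \<cdot>\<^sub>v (P *\<^sub>v x) + (- Im c) \<cdot>\<^sub>v (P *\<^sub>v y)) $ i"
      using arg_cong[OF comp[OF i], of Re] i A PC
      by (simp del: index_mult_mat_vec add: parts[OF A(1) i] parts[OF PC(1) i])
  qed (use A PC in auto)
  have ey: "A *\<^sub>v y = Im c \<cdot>\<^sub>v (P *\<^sub>v x) + Re c \<cdot>\<^sub>v (P *\<^sub>v y)"
  proof (rule eq_vecI)
    fix i assume "i < dim_vec (Im c \<cdot>\<^sub>v (P *\<^sub>v x) + Re c \<cdot>\<^sub>v (P *\<^sub>v y))"
    then have i: "i < n" using PC by auto
    show "(A *\<^sub>v y) $ i = (Im c \<cdot>\<^sub>v (P *\<^sub>v x) + Re c \<cdot>\<^sub>v (P *\<^sub>v y)) $ i"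
      using arg_cong[OF comp[OF i], of Im] i A PC
      by (simp del: index_mult_mat_vec add: parts[OF A(1) i] parts[OF PC(1) i])
  qed (use A PC in auto)
  have car: "P *\<^sub>v x \<in> carrier_vec n" "P *\<^sub>v y \<in> carrier_vec n" using PC xy by auto
  have "scalar_prod y (A *\<^sub>v x) = scalar_prod x (A *\<^sub>v y)"
    "scalar_prod y (P *\<^sub>v x) = scalar_prod x (P *\<^sub>v y)"
    using symmetric_form_commute A PC xy by blast+
  then have "Im c * (scalar_prod x (P *\<^sub>v x) + scalar_prod y (P *\<^sub>v y)) = 0"
    unfolding ex ey using xy car by (simp add: scalar_prod_add_distrib[where n=n] algebra_simps)
  moreover have "0 < scalar_prod x (P *\<^sub>v x) + scalar_prod y (P *\<^sub>v y)"
    using pos_def_forms_add_pos[OF P P xy nz] .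
  ultimately have im: "Im c = 0" by simp
  have "A *\<^sub>v x = Re c \<cdot>\<^sub>v (P *\<^sub>v x)" "A *\<^sub>v y = Re c \<cdot>\<^sub>v (P *\<^sub>v y)"
    unfolding ex ey im using car by (auto simp: smult_vec_def intro!: eq_vecI)
  moreover have "c = complex_of_real (Re c)" using im by (simp add: complex_eq_iff)
  ultimately show ?thesis using nz xy by blast
qed

text \<open>
With \<open>w = sqrt \<eta> y\<close>, the first block row is the first equation as it stands; the second one is the
second block row divided by \<open>sqrt \<eta>\<close>.
\<close>
lemma saddle_eigenpair_to_coupled_pencil:
  assumes KC: "K \<in> carrier_mat n n" and MC: "M \<in> carrier_mat n n" and \<eta>: "0 < \<eta>"
    and z: "z \<in> carrier_vec (n + n)" "z \<noteq> 0\<^sub>v (n + n)"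
    and eq: "saddle_matrix \<eta> K M *\<^sub>v z = r \<cdot>\<^sub>v (preconditioner n \<eta> K M *\<^sub>v z)"
  shows "\<exists>x w. x \<in> carrier_vec n \<and> w \<in> carrier_vec n \<and> (x \<noteq> 0\<^sub>v n \<or> w \<noteq> 0\<^sub>v n) \<and>
     K *\<^sub>v x + (\<eta> powr (-1/2) \<cdot>\<^sub>m M) *\<^sub>v w = r \<cdot>\<^sub>v (K *\<^sub>v x + (\<eta> powr (-1/2) \<cdot>\<^sub>m M) *\<^sub>v x) \<and>
     (\<eta> powr (-1/2) \<cdot>\<^sub>m M) *\<^sub>v x - K *\<^sub>v w = r \<cdot>\<^sub>v (K *\<^sub>v w + (\<eta> powr (-1/2) \<cdot>\<^sub>m M) *\<^sub>v w)"
proof -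
  define q where "q = sqrt \<eta>"
  have q: "0 < q" "\<eta> = q * q" using \<eta> by (auto simp: q_def)
  have pw: "\<eta> powr (1/2) = q" "\<eta> powr (-1/2) = 1 / q"
    using \<eta> by (auto simp: q_def powr_half_sqrt powr_minus_divide)
  define x y where "x = vec_first z n" and "y = vec_last z n"
  define w where "w = q \<cdot>\<^sub>v y"
  have xy: "x \<in> carrier_vec n" "y \<in> carrier_vec n" and zxy: "z = x @\<^sub>v y"
    using z by (auto simp: x_def y_def)
  have w: "w \<in> carrier_vec n" using xy by (simp add: w_def)
  have nz: "x \<noteq> 0\<^sub>v n \<or> w \<noteq> 0\<^sub>v n"
  proof (rule ccontr)
    assume "\<not> ?thesis"
    then have "x = 0\<^sub>v n" "y = 0\<^sub>v n" using smult_vec_eq_0D[of q y n] q by (auto simp: w_def)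
    then have "z = 0\<^sub>v (n + n)" unfolding zxy by (auto intro!: eq_vecI)
    with z show False by blast
  qed
  let ?T = "K + (1 / q) \<cdot>\<^sub>m M" and ?B = "\<eta> \<cdot>\<^sub>m K + q \<cdot>\<^sub>m M"
  have TC: "?T \<in> carrier_mat n n" and BC: "?B \<in> carrier_mat n n" and EC: "(- \<eta>) \<cdot>\<^sub>m K \<in> carrier_mat n n"
    using KC MC by auto
  have "saddle_matrix \<eta> K M *\<^sub>v z = (K *\<^sub>v x + M *\<^sub>v y) @\<^sub>v (M *\<^sub>v x + ((- \<eta>) \<cdot>\<^sub>m K) *\<^sub>v y)"
    unfolding saddle_matrix_def zxy by (rule four_block_mat_mult_vec[OF KC MC MC EC xy])
  moreover have "preconditioner n \<eta> K M *\<^sub>v z = (?T *\<^sub>v x) @\<^sub>v (?B *\<^sub>v y)"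
    unfolding preconditioner_def pw zxy by (rule mult_mat_vec_split[OF TC BC xy])
  ultimately have E: "(K *\<^sub>v x + M *\<^sub>v y) @\<^sub>v (M *\<^sub>v x + ((- \<eta>) \<cdot>\<^sub>m K) *\<^sub>v y)
      = r \<cdot>\<^sub>v ((?T *\<^sub>v x) @\<^sub>v (?B *\<^sub>v y))" using eq by simp
  have "r \<cdot>\<^sub>v ((?T *\<^sub>v x) @\<^sub>v (?B *\<^sub>v y)) = (r \<cdot>\<^sub>v (?T *\<^sub>v x)) @\<^sub>v (r \<cdot>\<^sub>v (?B *\<^sub>v y))"
    by (intro eq_vecI) auto
  note E = E[unfolded this]
  have E1: "K *\<^sub>v x + M *\<^sub>v y = r \<cdot>\<^sub>v (?T *\<^sub>v x)"
    and E2: "M *\<^sub>v x + ((- \<eta>) \<cdot>\<^sub>m K) *\<^sub>v y = r \<cdot>\<^sub>v (?B *\<^sub>v y)"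
  proof -
    have "K *\<^sub>v x + M *\<^sub>v y \<in> carrier_vec n" "r \<cdot>\<^sub>v (?T *\<^sub>v x) \<in> carrier_vec n"
      using KC MC xy mult_mat_vec_carrier[OF TC xy(1)] by auto
    from E[unfolded append_vec_eq[OF this]]
    show "K *\<^sub>v x + M *\<^sub>v y = r \<cdot>\<^sub>v (?T *\<^sub>v x)"
      "M *\<^sub>v x + ((- \<eta>) \<cdot>\<^sub>m K) *\<^sub>v y = r \<cdot>\<^sub>v (?B *\<^sub>v y)" by blast+
  qed
  define a b c d where "a i = (K *\<^sub>v x) $ i" and "b i = (M *\<^sub>v x) $ i"
    and "c i = (K *\<^sub>v y) $ i" and "d i = (M *\<^sub>v y) $ i" for i
  note abcd = a_def b_def c_def d_def
  have s: "(s \<cdot>\<^sub>m X) *\<^sub>v v = s \<cdot>\<^sub>v (X *\<^sub>v v)" if "X \<in> carrier_mat n n" "v \<in> carrier_vec n"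
    for s :: real and X v using that by (rule smult_mat_mult_vec)
  have e1: "a i + d i = r * (a i + 1 / q * b i)" if "i < n" for i
  proof -
    have "?T *\<^sub>v x = K *\<^sub>v x + (1 / q) \<cdot>\<^sub>v (M *\<^sub>v x)"
      using KC MC xy by (simp add: add_mult_distrib_mat_vec[where nr=n and nc=n] s)
    then show ?thesis using arg_cong[OF E1, of "\<lambda>v. v $ i"] that KC MC xy
      by (simp add: abcd del: index_mult_mat_vec)
  qed
  have e2: "b i - \<eta> * c i = r * (\<eta> * c i + q * d i)" if "i < n" for i
  proof -
    have "?B *\<^sub>v y = \<eta> \<cdot>\<^sub>v (K *\<^sub>v y) + q \<cdot>\<^sub>v (M *\<^sub>v y)"
      using KC MC xy by (simp add: add_mult_distrib_mat_vec[where nr=n and nc=n] s)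
    then show ?thesis using arg_cong[OF E2, of "\<lambda>v. v $ i"] that KC MC xy
      by (simp add: abcd s del: index_mult_mat_vec)
  qed
  have Kw: "K *\<^sub>v w = q \<cdot>\<^sub>v (K *\<^sub>v y)" and Mw: "M *\<^sub>v w = q \<cdot>\<^sub>v (M *\<^sub>v y)"
    unfolding w_def using KC MC xy by (auto simp: mult_mat_vec)
  have p1: "K *\<^sub>v x + ((1 / q) \<cdot>\<^sub>m M) *\<^sub>v w = r \<cdot>\<^sub>v (K *\<^sub>v x + ((1 / q) \<cdot>\<^sub>m M) *\<^sub>v x)"
    unfolding s[OF MC w] s[OF MC xy(1)] Mw
    using e1 q KC MC by (intro eq_vecI) (auto simp: abcd simp del: index_mult_mat_vec)
  have p2: "((1 / q) \<cdot>\<^sub>m M) *\<^sub>v x - K *\<^sub>v w = r \<cdot>\<^sub>v (K *\<^sub>v w + ((1 / q) \<cdot>\<^sub>m M) *\<^sub>v w)"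
  proof -
    have "1 / q * b i - q * c i = r * (q * c i + 1 / q * (q * d i))" if "i < n" for i
    proof -
      have "1 / q * b i - q * c i = 1 / q * (b i - \<eta> * c i)"
        using q by (simp add: field_simps)
      also have "\<dots> = r * (q * c i + 1 / q * (q * d i))"
        unfolding e2[OF that] using q by (simp add: field_simps)
      finally show ?thesis .
    qed
    then show ?thesis unfolding s[OF MC w] s[OF MC xy(1)] Mw Kw
      using KC MC by (intro eq_vecI) (auto simp: abcd simp del: index_mult_mat_vec)
  qed
  show ?thesis unfolding pw
    by (intro exI[of _ x] exI[of _ w] conjI xy(1) w nz p1 p2)
qed

section \<open>Integrals over the triangulated square\<close>

lemma closure_Omega: "closure Omega = cbox (0, 0) (1, 1)"
  and Omega_box: "Omega = box (0, 0) (1, 1)"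
proof -
  show "Omega = box (0, 0) (1, 1)"
    by (auto simp: Omega_def mem_box Basis_prod_def)
  show "closure Omega = cbox (0, 0) (1, 1)"
    by (simp add: Omega_def closure_Times cbox_Pair_eq)
qed

text \<open>
On the compact closure, continuity of finite element functions gives integrability at once.
\<close>
lemma integral_Omega: "integral Omega f = integral (closure Omega) f"
  and integrable_Omega: "f integrable_on Omega \<longleftrightarrow> f integrable_on closure Omega"
  for f :: "real \<times> real \<Rightarrow> real"
  unfolding closure_Omega unfolding Omega_box
  by (simp_all add: integral_open_interval integrable_on_open_interval)

lemma triangle_interior_nonempty:
  fixes T :: "(real \<times> real) set"
  assumes "2 simplex T" shows "interior T \<noteq> {}"
proof -
  have "aff_dim T = 2" using assms by (rule aff_dim_simplex)
  then have "affine hull T = UNIV" "T \<noteq> {}" using aff_dim_eq_full[of T] by force+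
  then show ?thesis
    using rel_interior_interior[of T] rel_interior_eq_empty[of T] convex_simplex[OF assms] by auto
qed

text \<open>
Products of gradients of finite element functions are constant inside each triangle but unspecified
on the edges. On a single triangle the boundary is negligible, being the frontier of a convex set.
Absolute integrability is used because it passes to arbitrary finite unions.
\<close>
lemma integrable_if_constant_on_triangles:
  fixes f :: "real \<times> real \<Rightarrow> real"
  assumes tri: "triangulation_of_Omega \<T>"
    and const: "\<And>T. T \<in> \<T> \<Longrightarrow> \<exists>c. \<forall>x\<in>interior T. f x = c"
  shows "f integrable_on Omega"
proof -
  have fin: "finite \<T>" and U: "\<Union>\<T> = closure Omega"
    and sx: "\<And>T. T \<in> \<T> \<Longrightarrow> 2 simplex T"
    using tri by (auto simp: triangulation_of_Omega_def triangulation_def)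
  have "f absolutely_integrable_on T" if T: "T \<in> \<T>" for T
  proof -
    obtain c where c: "\<And>x. x \<in> interior T \<Longrightarrow> f x = c" using const[OF T] by blast
    have "(\<lambda>x. c) absolutely_integrable_on T"
      using compact_simplex[OF sx[OF T]] by (intro absolutely_integrable_on_const lmeasurable_compact)
    then show ?thesis
    proof (rule absolutely_integrable_spike)
      show "negligible (frontier T)" by (rule negligible_convex_frontier[OF convex_simplex[OF sx[OF T]]])
      show "f x = c" if "x \<in> T - frontier T" for x
        using that c[of x] closure_subset[of T] unfolding frontier_def by blast
    qed
  qed
  with fin have "f absolutely_integrable_on \<Union>\<T>"
  proof (induction \<T>)
    case (insert T \<T>)
    then show ?case by (simp add: absolutely_integrable_Un)
  qed simp
  then show ?thesis
    unfolding integrable_Omega U by (simp add: absolutely_integrable_on_def)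
qed

text \<open>
A nondegenerate box inside the triangle carries no more of the integral of a nonnegative function
than the whole square does.
\<close>
lemma integral_zero_imp_zero_on_triangle:
  fixes f :: "real \<times> real \<Rightarrow> real"
  assumes tri: "triangulation_of_Omega \<T>" and T: "T \<in> \<T>"
    and int: "f integrable_on Omega" and nonneg: "\<And>x. 0 \<le> f x"
    and zero: "integral Omega f = 0" and const: "\<And>x. x \<in> interior T \<Longrightarrow> f x = c"
  shows "c = 0"
proof -
  have "2 simplex T" and sub: "T \<subseteq> closure Omega"
    using tri T by (auto simp: triangulation_of_Omega_def)
  then obtain p where p: "p \<in> interior T" using triangle_interior_nonempty by blast
  obtain l u where lu: "cbox l u \<subseteq> interior T" "p \<in> box l u"
    using open_contains_cbox[OF open_interior p] by metis
  have fi: "f integrable_on cbox l u"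
  proof (rule integrable_eq[OF integrable_const[of c l u]])
    show "c = f x" if "x \<in> cbox l u" for x using const[of x] lu(1) that by auto
  qed
  have "integral (cbox l u) f \<le> integral (closure Omega) f"
  proof (rule integral_subset_le)
    show "cbox l u \<subseteq> closure Omega" using lu(1) sub interior_subset[of T] by blast
  qed (use int fi nonneg in \<open>auto simp: integrable_Omega\<close>)
  moreover have "0 \<le> integral (cbox l u) f" using fi nonneg by (intro integral_nonneg) auto
  ultimately have "(f has_integral 0) (cbox l u)"
    using zero integrable_integral[OF fi] unfolding integral_Omega by simp
  then have "((\<lambda>x. c) has_integral 0) (cbox l u)"
  proof (rule has_integral_eq[rotated])
    show "f x = c" if "x \<in> cbox l u" for x using const[of x] lu(1) that by auto
  qed
  moreover have "0 \<le> c" using nonneg[of p] const[OF p] by simp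
  ultimately show ?thesis
    using has_integral_0_cbox_imp_0[of l u "\<lambda>x. c" p] lu(2) box_subset_cbox[of l u]
    by (metis continuous_on_const empty_iff subsetD)
qed

text \<open>
Mass and stiffness matrix are both of this form, so that their quadratic forms are integrals of
squares. Integrability is essential: a nonintegrable entry would be given the integral 0.
\<close>
lemma quadratic_form_matrix_of_integrals:
  fixes F :: "nat \<Rightarrow> nat \<Rightarrow> 'a::euclidean_space \<Rightarrow> real"
  assumes c: "c \<in> carrier_vec n"
    and int: "\<And>i j. i < n \<Longrightarrow> j < n \<Longrightarrow> F i j integrable_on S"
  shows "scalar_prod c (mat n n (\<lambda>(i, j). integral S (F i j)) *\<^sub>v c) =
      integral S (\<lambda>x. \<Sum>i<n. \<Sum>j<n. c $ i * c $ j * F i j x)"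
proof -
  have "scalar_prod c (mat n n (\<lambda>(i, j). integral S (F i j)) *\<^sub>v c) =
      (\<Sum>i<n. \<Sum>j<n. c $ i * c $ j * integral S (F i j))"
    using c by (auto simp: scalar_prod_def sum_distrib_left atLeast0LessThan mult_ac intro!: sum.cong)
  also have "\<dots> = integral S (\<lambda>x. \<Sum>i<n. \<Sum>j<n. c $ i * c $ j * F i j x)"
  proof -
    have "integral S (\<lambda>x. \<Sum>i<n. \<Sum>j<n. c $ i * c $ j * F i j x) =
        (\<Sum>i<n. integral S (\<lambda>x. \<Sum>j<n. c $ i * c $ j * F i j x))"
      by (intro integral_sum integrable_sum integrable_on_mult_right int) auto
    also have "\<dots> = (\<Sum>i<n. \<Sum>j<n. integral S (\<lambda>x. c $ i * c $ j * F i j x))"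
      by (intro sum.cong refl integral_sum integrable_on_mult_right int) auto
    finally show ?thesis by simp
  qed
  finally show ?thesis .
qed

section \<open>Finite element functions\<close>

text \<open>
Inside the triangle the function agrees with an affine one near the point, and gradients are unique.
\<close>
lemma gradient_affine_on:
  assumes "\<And>y. y \<in> T \<Longrightarrow> v y = a + inner g y" "x \<in> interior T"
  shows "gradient v x = g"
proof -
  have D: "GDERIV v x :> g"
  proof -
    have "FDERIV (\<lambda>y. a + inner g y) x :> (\<lambda>h. inner h g)"
      by (auto intro!: derivative_eq_intros simp: inner_commute)
    then show ?thesis unfolding gderiv_def
    proof (rule has_derivative_transform_within_open)
      show "a + inner g y = v y" if "y \<in> interior T" for y
        using assms(1)[of y] that interior_subset[of T] by auto
    qed (use assms(2) in auto)
  qed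
  show ?thesis unfolding gradient_def
  proof (rule the_equality[where P="\<lambda>D. GDERIV v x :> D", OF D])
    fix D' assume "GDERIV v x :> D'"
    then have "(\<lambda>h. inner h D') = (\<lambda>h. inner h g)"
      using D unfolding gderiv_def by (rule has_derivative_unique)
    then have "inner h (D' - g) = 0" for h by (metis inner_diff_right cancel_comm_monoid_add_class.diff_cancel)
    from this[of "D' - g"] show "D' = g" by simp
  qed
qed

lemma fe_space_lincomb:
  assumes "\<And>i. i < n \<Longrightarrow> b i \<in> fe_space \<T>"
  shows "(\<lambda>x. \<Sum>i<n. c i * b i x) \<in> fe_space \<T>"
proof -
  have "\<exists>a g. \<forall>x\<in>T. (\<Sum>i<n. c i * b i x) = a + inner g x" if T: "T \<in> \<T>" for T
  proof -
    have "\<forall>i<n. \<exists>a g. \<forall>x\<in>T. b i x = a + inner g x"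
      using assms T by (auto simp: fe_space_def)
    then obtain a g where ag: "\<And>i x. i < n \<Longrightarrow> x \<in> T \<Longrightarrow> b i x = a i + inner (g i) x"
      by metis
    have "(\<Sum>i<n. c i * b i x) = (\<Sum>i<n. c i * a i) + inner (\<Sum>i<n. c i *\<^sub>R g i) x"
      if "x \<in> T" for x
      using ag that by (simp add: inner_sum_left sum.distrib algebra_simps)
    then show ?thesis by blast
  qed
  moreover have "continuous_on (closure Omega) (\<lambda>x. \<Sum>i<n. c i * b i x)"
    using assms by (intro continuous_intros) (auto simp: fe_space_def)
  ultimately show ?thesis by (simp add: fe_space_def)
qed

lemma gradient_constant_on_triangle:
  assumes "v \<in> fe_space \<T>" "T \<in> \<T>"
  shows "\<exists>a g. (\<forall>x\<in>T. v x = a + inner g x) \<and> (\<forall>x\<in>interior T. gradient v x = g)"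
proof -
  obtain a g where "\<And>x. x \<in> T \<Longrightarrow> v x = a + inner g x"
    using assms unfolding fe_space_def by blast
  then show ?thesis using gradient_affine_on by blast
qed

text \<open>
On each triangle the function is affine with gradient zero, hence constant, so it takes finitely many values
altogether. A continuous function with finitely many values on a connected set is constant; this
avoids walking from triangle to triangle through common edges.
\<close>
lemma fe_gradient_zero_imp_constant:
  assumes tri: "triangulation_of_Omega \<T>" and v: "v \<in> fe_space \<T>"
    and zero: "\<And>T. T \<in> \<T> \<Longrightarrow> \<exists>x\<in>interior T. gradient v x = 0"
  shows "\<exists>a. \<forall>x\<in>closure Omega. v x = a"
proof -
  have fin: "finite \<T>" and U: "\<Union>\<T> = closure Omega"
    using tri by (auto simp: triangulation_of_Omega_def triangulation_def)
  have "\<exists>a. \<forall>x\<in>T. v x = a" if T: "T \<in> \<T>" for T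
    using gradient_constant_on_triangle[OF v T] zero[OF T] by force
  then obtain a where a: "\<And>T x. T \<in> \<T> \<Longrightarrow> x \<in> T \<Longrightarrow> v x = a T" by metis
  have "v ` closure Omega \<subseteq> a ` \<T>" using a unfolding U[symmetric] by blast
  then have "finite (v ` closure Omega)" using fin finite_surj by blast
  moreover have "connected (v ` closure Omega)"
    using v by (intro connected_continuous_image)
      (auto simp: fe_space_def closure_Omega intro: convex_connected convex_box)
  ultimately show ?thesis 
    using connected_finite_iff_sing[of "v ` closure Omega"] by (metis empty_iff image_eqI singletonD)
qed

text \<open>
The coefficients are the values at the nodes.
\<close>
lemma nodal_combination_zero_imp_coefficients_zero:
  assumes tri: "triangulation_of_Omega \<T>" and nod: "nodal_basis \<T> \<phi>"
    and bij: "bij_betw \<nu> {..<n} (nodes \<T>)" and c: "c \<in> carrier_vec n"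
    and zero: "\<And>x. x \<in> closure Omega \<Longrightarrow> (\<Sum>i<n. c $ i * \<phi> (\<nu> i) x) = 0"
  shows "c = 0\<^sub>v n"
proof (rule eq_vecI)
  fix i assume "i < dim_vec (0\<^sub>v n :: real vec)"
  then have i: "i < n" by simp
  have node: "\<nu> j \<in> nodes \<T>" if "j < n" for j using bij that by (auto simp: bij_betw_def)
  have "\<nu> i \<in> closure Omega"
    using node[OF i] tri by (auto simp: nodes_def triangulation_of_Omega_def extreme_point_of_def)
  then have "0 = (\<Sum>j<n. c $ j * \<phi> (\<nu> j) (\<nu> i))" using zero by simp
  also have "\<dots> = (\<Sum>j<n. if j = i then c $ j else 0)"
  proof (rule sum.cong)
    fix j assume "j \<in> {..<n}"
    then have j: "j < n" by simp
    then have "\<phi> (\<nu> j) (\<nu> i) = (if j = i then 1 else 0)"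
      using nod node[OF i] node[OF j] bij i
      by (auto simp: nodal_basis_def bij_betw_def inj_on_def)
    then show "c $ j * \<phi> (\<nu> j) (\<nu> i) = (if j = i then c $ j else 0)" by simp
  qed simp
  also have "\<dots> = c $ i" using i by simp
  finally show "c $ i = 0\<^sub>v n $ i" using i by simp
qed (use c in simp)

section \<open>Positive definiteness of the finite element matrices\<close>

lemma pos_def_mass_matrix:
  assumes tri: "triangulation_of_Omega \<T>" and nod: "nodal_basis \<T> \<phi>"
    and bij: "bij_betw \<nu> {..<n} (nodes \<T>)"
  shows "pos_def n (mass_matrix n (\<lambda>i. \<phi> (\<nu> i)))"
proof -
  have cont: "continuous_on (closure Omega) (\<phi> (\<nu> i))" if "i < n" for i
    using nod bij that by (auto simp: nodal_basis_def fe_space_def bij_betw_def)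
  have pos: "0 < scalar_prod c (mass_matrix n (\<lambda>i. \<phi> (\<nu> i)) *\<^sub>v c)"
    if c: "c \<in> carrier_vec n" and nz: "c \<noteq> 0\<^sub>v n" for c
  proof -
    define v where "v x = (\<Sum>i<n. c $ i * \<phi> (\<nu> i) x)" for x
    have int: "(\<lambda>x. \<phi> (\<nu> i) x * \<phi> (\<nu> j) x) integrable_on Omega" if "i < n" "j < n" for i j
      unfolding integrable_Omega closure_Omega using cont that
      by (intro integrable_continuous continuous_intros) (auto simp: closure_Omega)
    have "scalar_prod c (mass_matrix n (\<lambda>i. \<phi> (\<nu> i)) *\<^sub>v c) =
        integral Omega (\<lambda>x. \<Sum>i<n. \<Sum>j<n. c $ i * c $ j * (\<phi> (\<nu> i) x * \<phi> (\<nu> j) x))"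
      unfolding mass_matrix_def using c int by (rule quadratic_form_matrix_of_integrals)
    also have "\<dots> = integral (cbox (0,0) (1,1)) (\<lambda>x. (v x)\<^sup>2)"
      unfolding integral_Omega closure_Omega v_def
      by (simp add: power2_eq_square sum_product mult_ac)
    finally have form: "scalar_prod c (mass_matrix n (\<lambda>i. \<phi> (\<nu> i)) *\<^sub>v c) =
        integral (cbox (0,0) (1,1)) (\<lambda>x. (v x)\<^sup>2)" .
    have vc: "continuous_on (cbox (0,0) (1,1)) (\<lambda>x. (v x)\<^sup>2)"
      unfolding v_def closure_Omega[symmetric] using cont by (intro continuous_intros) auto
    have ne: "box (0,0) (1,1::real) \<noteq> ({} :: (real \<times> real) set)"
      unfolding Omega_box[symmetric] Omega_def by auto
    have "integral (cbox (0,0) (1,1)) (\<lambda>x. (v x)\<^sup>2) \<noteq> 0"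
    proof
      assume "integral (cbox (0,0) (1,1)) (\<lambda>x. (v x)\<^sup>2) = 0"
      then have "v x = 0" if "x \<in> closure Omega" for x
        using integral_cbox_eq_0_iff[OF vc ne] that by (simp add: closure_Omega)
      then have "c = 0\<^sub>v n" using nodal_combination_zero_imp_coefficients_zero[OF tri nod bij c] by (simp add: v_def)
      with nz show False by blast
    qed
    moreover have "0 \<le> integral (cbox (0,0) (1,1)) (\<lambda>x. (v x)\<^sup>2)"
      by (intro integral_nonneg integrable_continuous vc) simp
    ultimately show ?thesis unfolding form by simp
  qed
  have "transpose_mat (mass_matrix n (\<lambda>i. \<phi> (\<nu> i))) = mass_matrix n (\<lambda>i. \<phi> (\<nu> i))"
    by (rule eq_matI) (auto simp: mass_matrix_def mult.commute)
  then show ?thesis using pos by (auto simp: pos_def_def mass_matrix_def)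
qed

text \<open>
The stiffness matrix alone has the constants in its kernel. The rank one term from the mean values
is positive on them.
\<close>
lemma pos_def_stiffness_plus_mean:
  assumes tri: "triangulation_of_Omega \<T>" and nod: "nodal_basis \<T> \<phi>"
    and bij: "bij_betw \<nu> {..<n} (nodes \<T>)"
  shows "pos_def n (stiffness_matrix n (\<lambda>i. \<phi> (\<nu> i)) + outer_square (mean_vector n (\<lambda>i. \<phi> (\<nu> i))))"
proof -
  let ?b = "\<lambda>i. \<phi> (\<nu> i)"
  let ?K = "stiffness_matrix n ?b" and ?m = "mean_vector n ?b"
  have fe: "?b i \<in> fe_space \<T>" if "i < n" for i
    using nod bij that by (auto simp: nodal_basis_def bij_betw_def)
  have KC: "?K \<in> carrier_mat n n" and mC: "?m \<in> carrier_vec n" and OC: "outer_square ?m \<in> carrier_mat n n"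
    by (auto simp: stiffness_matrix_def mean_vector_def outer_square_def)
  have pos: "0 < scalar_prod c ((?K + outer_square ?m) *\<^sub>v c)"
    if c: "c \<in> carrier_vec n" and nz: "c \<noteq> 0\<^sub>v n" for c
  proof -
    define v where "v x = (\<Sum>i<n. c $ i * ?b i x)" for x
    define G where "G x = (\<Sum>i<n. c $ i *\<^sub>R gradient (?b i) x)" for x
    have vfe: "v \<in> fe_space \<T>" unfolding v_def by (rule fe_space_lincomb[OF fe])
    have grad: "\<exists>g. \<forall>x\<in>interior T. G x = g \<and> gradient v x = g" if T: "T \<in> \<T>" for T
    proof -
      have "\<forall>i<n. \<exists>a g. (\<forall>x\<in>T. ?b i x = a + inner g x) \<and> (\<forall>x\<in>interior T. gradient (?b i) x = g)"
        using gradient_constant_on_triangle[OF fe T] by blast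
      then obtain a g where ag: "\<And>i x. i < n \<Longrightarrow> x \<in> T \<Longrightarrow> ?b i x = a i + inner (g i) x"
        and gr: "\<And>i x. i < n \<Longrightarrow> x \<in> interior T \<Longrightarrow> gradient (?b i) x = g i"
        by metis
      have "v x = (\<Sum>i<n. c $ i * a i) + inner (\<Sum>i<n. c $ i *\<^sub>R g i) x" if "x \<in> T" for x
        using ag that by (simp add: v_def inner_sum_left sum.distrib algebra_simps)
      then have "gradient v x = (\<Sum>i<n. c $ i *\<^sub>R g i)" if "x \<in> interior T" for x
        using gradient_affine_on[of T v] that by blast
      moreover have "G x = (\<Sum>i<n. c $ i *\<^sub>R g i)" if "x \<in> interior T" for x
        using gr that by (simp add: G_def)
      ultimately show ?thesis by blast
    qed
    have int: "(\<lambda>x. inner (gradient (?b i) x) (gradient (?b j) x)) integrable_on Omega"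
      if ij: "i < n" "j < n" for i j
    proof (rule integrable_if_constant_on_triangles[OF tri])
      fix T assume T: "T \<in> \<T>"
      obtain g g' where "\<forall>x\<in>interior T. gradient (?b i) x = g" "\<forall>x\<in>interior T. gradient (?b j) x = g'"
        using gradient_constant_on_triangle[OF fe[OF ij(1)] T] gradient_constant_on_triangle[OF fe[OF ij(2)] T]
        by blast
      then show "\<exists>c. \<forall>x\<in>interior T. inner (gradient (?b i) x) (gradient (?b j) x) = c" by simp
    qed
    have Gint: "(\<lambda>x. inner (G x) (G x)) integrable_on Omega"
    proof (rule integrable_if_constant_on_triangles[OF tri])
      fix T assume "T \<in> \<T>"
      then show "\<exists>c. \<forall>x\<in>interior T. inner (G x) (G x) = c" using grad[of T] by force
    qed
    have "scalar_prod c (?K *\<^sub>v c) = integral Omega (\<lambda>x. \<Sum>i<n. \<Sum>j<n. c $ i * c $ j *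
        inner (gradient (?b i) x) (gradient (?b j) x))"
      unfolding stiffness_matrix_def using c int by (rule quadratic_form_matrix_of_integrals)
    also have "\<dots> = integral Omega (\<lambda>x. inner (G x) (G x))"
      unfolding G_def by (simp add: inner_sum_left inner_sum_right sum_distrib_left mult_ac inner_commute)
    finally have Kform: "scalar_prod c (?K *\<^sub>v c) = integral Omega (\<lambda>x. inner (G x) (G x))" .
    have oc: "outer_square ?m *\<^sub>v c = scalar_prod ?m c \<cdot>\<^sub>v ?m"
      using c by (intro eq_vecI) (auto simp: outer_square_def mean_vector_def scalar_prod_def sum_distrib_left sum_distrib_right mult_ac intro!: sum.cong)
    have form: "scalar_prod c ((?K + outer_square ?m) *\<^sub>v c) =
        integral Omega (\<lambda>x. inner (G x) (G x)) + (scalar_prod ?m c)\<^sup>2"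
      using c KC OC mC Kform comm_scalar_prod[OF c mC]
      by (simp add: add_mult_distrib_mat_vec[where nr=n and nc=n] scalar_prod_add_distrib[where n=n]
          oc power2_eq_square)
    have Gnn: "0 \<le> integral Omega (\<lambda>x. inner (G x) (G x))" using Gint by (intro integral_nonneg) auto
    have "scalar_prod c ((?K + outer_square ?m) *\<^sub>v c) \<noteq> 0"
    proof
      assume "scalar_prod c ((?K + outer_square ?m) *\<^sub>v c) = 0"
      then have G0: "integral Omega (\<lambda>x. inner (G x) (G x)) = 0" and m0: "scalar_prod ?m c = 0"
        unfolding form using Gnn zero_le_power2[of "scalar_prod ?m c"] by (auto simp: add_nonneg_eq_0_iff)
      have "\<exists>x\<in>interior T. gradient v x = 0" if T: "T \<in> \<T>" for T
      proof -
        obtain g where g: "\<And>x. x \<in> interior T \<Longrightarrow> G x = g \<and> gradient v x = g" using grad[OF T] by blast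
        have "inner g g = 0"
          using integral_zero_imp_zero_on_triangle[OF tri T Gint _ G0, of "inner g g"] g by simp
        moreover obtain x where "x \<in> interior T"
          using triangle_interior_nonempty[of T] tri T by (auto simp: triangulation_of_Omega_def)
        ultimately show ?thesis using g by (metis inner_eq_zero_iff)
      qed
      then obtain a where a: "\<And>x. x \<in> closure Omega \<Longrightarrow> v x = a"
        using fe_gradient_zero_imp_constant[OF tri vfe] by blast
      have "scalar_prod ?m c = (\<Sum>i<n. c $ i * integral Omega (?b i))"
        using c by (auto simp: scalar_prod_def mean_vector_def atLeast0LessThan mult.commute intro!: sum.cong)
      also have "\<dots> = integral Omega v"
      proof -
        have "?b i integrable_on Omega" if "i < n" for i
          using fe[OF that] unfolding integrable_Omega closure_Omega
          by (intro integrable_continuous) (auto simp: fe_space_def closure_Omega)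
        then have "integral Omega v = (\<Sum>i<n. integral Omega (\<lambda>x. c $ i * ?b i x))"
          unfolding v_def by (intro integral_sum integrable_on_mult_right) auto
        then show ?thesis by simp
      qed
      also have "\<dots> = integral (cbox (0,0) (1,1)) (\<lambda>x::real\<times>real. a)"
        unfolding integral_Omega closure_Omega
        by (rule integral_cong) (use a in \<open>simp add: closure_Omega\<close>)
      also have "\<dots> = a" by (simp add: content_Pair)
      finally have "a = 0" using m0 by simp
      then have "c = 0\<^sub>v n" using a nodal_combination_zero_imp_coefficients_zero[OF tri nod bij c] by (simp add: v_def)
      with nz show False by blast
    qed
    moreover have "0 \<le> scalar_prod c ((?K + outer_square ?m) *\<^sub>v c)" unfolding form using Gnn by simp
    ultimately show ?thesis by simp
  qed
  have "transpose_mat (?K + outer_square ?m) = ?K + outer_square ?m"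
    by (rule eq_matI) (auto simp: stiffness_matrix_def outer_square_def mean_vector_def inner_commute mult.commute)
  then show ?thesis using pos KC OC by (auto simp: pos_def_def)
qed

section \<open>The spectrum of the preconditioned system\<close>

theorem theorem5p1:
  fixes \<T> :: "(real \<times> real) set set"
    and \<phi> :: "real \<times> real \<Rightarrow> real \<times> real \<Rightarrow> real"
    and \<nu> :: "nat \<Rightarrow> real \<times> real"
    and n :: nat
    and \<eta> :: real
    and M K Kbar P A :: "real mat"
    and m :: "real vec"
  assumes "triangulation_of_Omega \<T>"
    and "nodal_basis \<T> \<phi>"
    and "n = card (nodes \<T>)"
    and "bij_betw \<nu> {..<n} (nodes \<T>)"
    and "\<eta> > 0"
    and "M = mass_matrix n (\<lambda>i. \<phi> (\<nu> i))"
    and "K = stiffness_matrix n (\<lambda>i. \<phi> (\<nu> i))"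
    and "m = mean_vector n (\<lambda>i. \<phi> (\<nu> i))"
    and "Kbar = K + outer_square m"
    and "P = preconditioner n \<eta> Kbar M"
    and "A = saddle_matrix \<eta> Kbar M"
  shows "invertible_mat P \<and>
    complex_spectrum (the (mat_inverse P) * A)
      \<subseteq> complex_of_real ` ({-1<..-1 / sqrt 2} \<union> {1 / sqrt 2..<1}) \<and>
    ((\<forall>u\<in>carrier_vec n. Kbar *\<^sub>v u = (\<eta> powr (-1/2)) \<cdot>\<^sub>v (M *\<^sub>v u) \<longrightarrow> u = 0\<^sub>v n) \<longrightarrow>
      complex_spectrum (the (mat_inverse P) * A)
        \<subseteq> complex_of_real ` ({-1<..<-1 / sqrt 2} \<union> {1 / sqrt 2<..<1}))"
proof -
  let ?s = "\<eta> powr (-1/2)"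
  have M: "pos_def n M" and K: "pos_def n Kbar"
    using pos_def_mass_matrix pos_def_stiffness_plus_mean assms by blast+
  have N: "pos_def n (?s \<cdot>\<^sub>m M)" using pos_def_smult[OF M] assms(5) by simp
  have KC: "Kbar \<in> carrier_mat n n" "transpose_mat Kbar = Kbar"
    and MC: "M \<in> carrier_mat n n" "transpose_mat M = M" using M K by (auto simp: pos_def_def)
  have P: "pos_def (n + n) P"
    unfolding assms(10) preconditioner_def
    using assms(5) by (intro pos_def_block_diag pos_def_add pos_def_smult K M) auto
  then have PC: "P \<in> carrier_mat (n + n) (n + n)" by (simp add: pos_def_def)
  have E: "(- \<eta>) \<cdot>\<^sub>m Kbar \<in> carrier_mat n n" using KC by simp
  have A: "A \<in> carrier_mat (n + n) (n + n)" "transpose_mat A = A"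
    unfolding assms(11) saddle_matrix_def using KC MC
    by (simp_all add: transpose_four_block_mat[OF KC(1) MC(1) MC(1) E] transpose_smult_mat)
  obtain B where B: "mat_inverse P = Some B" "B \<in> carrier_mat (n + n) (n + n)"
    "P * B = 1\<^sub>m (n + n)" "B * P = 1\<^sub>m (n + n)" using pos_def_mat_inverse[OF P] by blast
  have inv: "invertible_mat P"
    unfolding invertible_mat_def inverts_mat_def using B PC by auto
  have eig: "\<exists>r. c = complex_of_real r \<and> \<bar>r\<bar> < 1 \<and> 1 / sqrt 2 \<le> \<bar>r\<bar> \<and>
      ((\<forall>u\<in>carrier_vec n. Kbar *\<^sub>v u = ?s \<cdot>\<^sub>v (M *\<^sub>v u) \<longrightarrow> u = 0\<^sub>v n) \<longrightarrow> 1 / sqrt 2 < \<bar>r\<bar>)"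
    if c: "c \<in> complex_spectrum (the (mat_inverse P) * A)" for c
  proof -
    obtain z where "z \<in> carrier_vec (n + n)" "z \<noteq> 0\<^sub>v (n + n)"
      "map_mat complex_of_real A *\<^sub>v z = c \<cdot>\<^sub>v (map_mat complex_of_real P *\<^sub>v z)"
      using complex_spectrum_inverse_mult[OF A(1) PC B(2,3)] c B(1) by auto
    then obtain r v where r: "c = complex_of_real r" and v: "v \<in> carrier_vec (n + n)" "v \<noteq> 0\<^sub>v (n + n)"
      "A *\<^sub>v v = r \<cdot>\<^sub>v (P *\<^sub>v v)" using generalized_eigenpair_real[OF A P] by blast
    obtain x w where "x \<in> carrier_vec n" "w \<in> carrier_vec n" "x \<noteq> 0\<^sub>v n \<or> w \<noteq> 0\<^sub>v n"
      "Kbar *\<^sub>v x + (?s \<cdot>\<^sub>m M) *\<^sub>v w = r \<cdot>\<^sub>v (Kbar *\<^sub>v x + (?s \<cdot>\<^sub>m M) *\<^sub>v x)"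
      "(?s \<cdot>\<^sub>m M) *\<^sub>v x - Kbar *\<^sub>v w = r \<cdot>\<^sub>v (Kbar *\<^sub>v w + (?s \<cdot>\<^sub>m M) *\<^sub>v w)"
      using saddle_eigenpair_to_coupled_pencil[OF KC(1) MC(1) assms(5) v(1,2)] v(3) unfolding assms(10,11) by blast
    note b = coupled_pencil_eigenvalue_bounds[OF K N this]
    have "(?s \<cdot>\<^sub>m M) *\<^sub>v u = ?s \<cdot>\<^sub>v (M *\<^sub>v u)" if "u \<in> carrier_vec n" for u
      using MC(1) that by (rule smult_mat_mult_vec)
    then show ?thesis using r b by (auto simp: one_le_two_square_iff one_less_two_square_iff)
  qed
  show ?thesis
  proof (intro conjI impI subsetI inv)
    fix c assume "c \<in> complex_spectrum (the (mat_inverse P) * A)"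
    from eig[OF this] show "c \<in> complex_of_real ` ({-1<..-1 / sqrt 2} \<union> {1 / sqrt 2..<1})"
      by (auto simp: abs_if split: if_splits)
  next
    fix c assume "\<forall>u\<in>carrier_vec n. Kbar *\<^sub>v u = ?s \<cdot>\<^sub>v (M *\<^sub>v u) \<longrightarrow> u = 0\<^sub>v n"
      "c \<in> complex_spectrum (the (mat_inverse P) * A)"
    with eig[of c] show "c \<in> complex_of_real ` ({-1<..<-1 / sqrt 2} \<union> {1 / sqrt 2<..<1})"
      by (auto simp: abs_if split: if_splits)
  qed
qed

end
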